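(* Let $\varphi$ be an Orlicz function and let $w=\{w(n)\}_{n\in\mathbb{N}}$ be a decreasing weight sequence. Then for any real sequence $x=\{x(n)\}$, $$\sum_{n=1}^\infty \varphi\left(\frac{x^*(n)}{w(n)}\right) w(n) = \inf\left\{\sum_{n=1}^\infty \varphi\left(\frac{|x(n)|}{v(n)}\right) v(n) : v\sim w,\ v\ge 0\right\}.$$
   Context: An Orlicz function is a convex, strictly increasing function $\varphi:\mathbb{R}_+\to\mathbb{R}_+$ with $\varphi(0)=0$. "Decreasing" means non-increasing. A weight sequence is a non-negative decreasing sequence of real numbers. For a real sequence $x$, $d_x(s)=|\{k\in\mathbb{N}:|x(k)|>s\}|$ (cardinality) and $x^*(n)=\inf\{s>0: d_x(s)\le n-1\}$, $n\in\mathbb{N}$ ($\inf\emptyset=\infty$). For sequences, $x\sim y$ means $x^*=y^*$. Convention: if $v(n)=0$, then $\varphi(|x(n)|/v(n))\,v(n)$ is defined to be $0$ if $x(n)=0$ and $\infty$ if $x(n)\ne0$ (the same convention with $x^*(n)$ and $w(n)$); the expression is $\infty$ if $x^*(n)=\infty$. Sums take values in $[0,\infty]$. *)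

theory Defs
  imports "HOL-Analysis.Analysis"
begin

text \<open>
  Sequences are indexed from 0, so entry \<open>n\<close> here is entry \<open>n + 1\<close> of the usual
  1-based notation.
\<close>

text \<open>
  Only the values of \<open>\<phi>\<close> on the half-line \<open>{0..}\<close> are meaningful.
\<close>

definition orlicz_function :: "(real \<Rightarrow> real) \<Rightarrow> bool" where
  "orlicz_function \<phi> \<longleftrightarrow>
     \<phi> \<in> {0..} \<rightarrow> {0..} \<and> convex_on {0..} \<phi> \<and> strict_mono_on {0..} \<phi> \<and> \<phi> 0 = 0"

definition weight_sequence :: "(nat \<Rightarrow> real) \<Rightarrow> bool" where
  "weight_sequence w \<longleftrightarrow> (\<forall>n. 0 \<le> w n) \<and> decseq w"

text \<open>
  The counting measure is used for the cardinality, because \<^const>\<open>card\<close> is 0 on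
  infinite sets.
\<close>

definition distribution :: "(nat \<Rightarrow> real) \<Rightarrow> real \<Rightarrow> ennreal" where
  "distribution x s = emeasure (count_space UNIV) {k. \<bar>x k\<bar> > s}"

text \<open>
  The bound \<open>n\<close> (rather than \<open>n - 1\<close>) is due to the 0-based indexing.
  In \<^typ>\<open>ennreal\<close> the infimum of the empty set is \<open>\<infinity>\<close>.
\<close>

definition decr_rearrangement :: "(nat \<Rightarrow> real) \<Rightarrow> nat \<Rightarrow> ennreal" where
  "decr_rearrangement x n = Inf {ennreal s | s. s > 0 \<and> distribution x s \<le> of_nat n}"

definition equimeasurable :: "(nat \<Rightarrow> real) \<Rightarrow> (nat \<Rightarrow> real) \<Rightarrow> bool" where
  "equimeasurable x y \<longleftrightarrow> decr_rearrangement x = decr_rearrangement y"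

text \<open>
  The expression \<open>\<phi> (a / v) * v\<close> for \<open>0 \<le> a \<le> \<infinity>\<close> and \<open>0 \<le> v < \<infinity>\<close>, with its
  conventions for \<open>v = 0\<close> and \<open>a = \<infinity>\<close>.
\<close>

definition weighted_term :: "(real \<Rightarrow> real) \<Rightarrow> ennreal \<Rightarrow> real \<Rightarrow> ennreal" where
  "weighted_term \<phi> a v =
     (if a = \<infinity> then \<infinity>
      else if v = 0 then (if a = 0 then 0 else \<infinity>)
      else ennreal (\<phi> (enn2real a / v) * v))"

end

theory Submission
  imports Defs
begin

text \<open>
  The perspective \<open>G(a, b) = \<phi> (a / b) * b\<close> of a convex function satisfies the exchange
  inequality \<open>G(a, b) + G(a', b') \<le> G(a, b') + G(a', b)\<close> for \<open>a' \<le> a\<close> and \<open>b' \<le> b\<close>, so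
  finite sums of \<open>G\<close> are smallest when both sequences are sorted the same way. If infinitely
  many entries of \<open>x\<close> exceed some positive constant, both sides are infinite because \<open>G\<close> is
  decreasing in \<open>b\<close> and \<open>v \<le> w 0\<close>. Otherwise \<open>x\<close> can be enumerated greedily in decreasing
  order of its moduli by an injection \<open>\<tau>\<close> that covers the support of \<open>x\<close>, and the infimum is
  attained at the \<open>v\<close> that carries \<open>w n\<close> to position \<open>\<tau> n\<close> and vanishes elsewhere.
\<close>

section \<open>Orlicz functions and their perspective\<close>

lemma orlicz_less: "orlicz_function \<phi> \<Longrightarrow> 0 \<le> s \<Longrightarrow> s < t \<Longrightarrow> \<phi> s < \<phi> t"
  unfolding orlicz_function_def strict_mono_on_def by auto

lemma orlicz_le: "orlicz_function \<phi> \<Longrightarrow> 0 \<le> s \<Longrightarrow> s \<le> t \<Longrightarrow> \<phi> s \<le> \<phi> t"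
  using orlicz_less[of \<phi> s t] by (cases "s = t") auto

lemma orlicz_zero: "orlicz_function \<phi> \<Longrightarrow> \<phi> 0 = 0"
  unfolding orlicz_function_def by auto

lemma orlicz_nonneg: "orlicz_function \<phi> \<Longrightarrow> 0 \<le> t \<Longrightarrow> 0 \<le> \<phi> t"
  using orlicz_le[of \<phi> 0 t] by (simp add: orlicz_zero)

text \<open>Convexity with the denominator \<open>p - q\<close> cleared, so that the bounds can be
  scaled and added below and \<open>p = q\<close> is allowed.\<close>

lemma convex_on_chord:
  fixes f :: "real \<Rightarrow> real"
  assumes "convex_on A f" "q \<in> A" "p \<in> A" "q \<le> t" "t \<le> p"
  shows "(p - q) * f t \<le> (t - q) * f p + (p - t) * f q"
proof (cases "p = q")
  case False
  with assms have pq: "q < p" by auto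
  define l where "l = (t - q) / (p - q)"
  have l: "0 \<le> l" "l \<le> 1" and l1: "1 - l = (p - t) / (p - q)"
    using assms pq by (auto simp: l_def field_simps)
  have "(1 - l) * q + l * p = q + l * (p - q)"
    by (simp add: algebra_simps)
  also have "\<dots> = t"
    using pq by (simp add: l_def)
  finally have t: "(1 - l) * q + l * p = t" .
  have "f t \<le> (1 - l) * f q + l * f p"
    using convex_onD[OF assms(1) l assms(2,3)] t by simp
  then have "(p - q) * f t \<le> (p - q) * ((1 - l) * f q + l * f p)"
    using pq by (intro mult_left_mono) auto
  also have "\<dots> = ((p - q) * l) * f p + ((p - q) * (1 - l)) * f q"
    by (simp add: algebra_simps)
  also have "\<dots> = (t - q) * f p + (p - t) * f q"
    unfolding l1 unfolding l_def using pq by simp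
  finally show ?thesis .
qed (use assms in auto)

text \<open>Since \<phi> vanishes at 0, the chord from 0 to \<open>a / b'\<close> shows that
  \<open>\<phi> t / t\<close> is nondecreasing; evaluate at \<open>t = a / b\<close>.\<close>

lemma perspective_antimono:
  assumes \<phi>: "orlicz_function \<phi>" and "0 \<le> a" "0 < b'" "b' \<le> b"
  shows "\<phi> (a / b) * b \<le> \<phi> (a / b') * b'"
proof (cases "a = 0")
  case False
  with assms have a: "0 < a" by simp
  have le: "a / b \<le> a / b'"
    using assms by (intro divide_left_mono) auto
  have "(a / b' - 0) * \<phi> (a / b) \<le> (a / b - 0) * \<phi> (a / b') + (a / b' - a / b) * \<phi> 0"
    using \<phi> assms le by (intro convex_on_chord[where A = "{0..}"]) (auto simp: orlicz_function_def)
  then show ?thesis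
    using a assms by (simp add: orlicz_zero[OF \<phi>] field_simps)
qed (simp add: orlicz_zero[OF \<phi>])

text \<open>Both \<open>a / b\<close> and \<open>a' / b'\<close> lie between
  \<open>q = a' / b\<close> and \<open>p = a / b'\<close>, so the chord over this interval bounds
  \<phi> at both. Weighted by \<open>b\<close> and \<open>b'\<close>, the two bounds add up exactly
  to the right-hand side, because
  \<open>b * (a / b) + b' * (a' / b') = a + a' = b' * p + b * q\<close>.\<close>

lemma perspective_exchange:
  assumes \<phi>: "convex_on {0..} \<phi>" and a: "0 \<le> a'" "a' \<le> a" and b: "0 < b'" "b' \<le> b"
  shows "\<phi> (a / b) * b + \<phi> (a' / b') * b' \<le> \<phi> (a / b') * b' + \<phi> (a' / b) * b"
proof -
  define p q where "p = a / b'" and "q = a' / b"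
  have q: "0 \<le> q" using a b by (simp add: q_def)
  have ab: "q \<le> a / b" "a / b \<le> p" and ab': "q \<le> a' / b'" "a' / b' \<le> p"
    using a b by (auto simp: p_def q_def intro: divide_right_mono divide_left_mono)
  show ?thesis
  proof (cases "p = q")
    case True
    then have "a / b = q" "a' / b' = q" "a / b' = q" "a' / b = q"
      using ab ab' by (auto simp: p_def q_def)
    then show ?thesis by simp
  next
    case False
    with ab have pq: "q < p" by linarith
    have 1: "(p - q) * \<phi> (a / b) \<le> (a / b - q) * \<phi> p + (p - a / b) * \<phi> q"
      using q pq ab by (intro convex_on_chord[OF \<phi>]) auto
    have 2: "(p - q) * \<phi> (a' / b') \<le> (a' / b' - q) * \<phi> p + (p - a' / b') * \<phi> q"
      using q pq ab' by (intro convex_on_chord[OF \<phi>]) auto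
    have "(p - q) * (\<phi> (a / b) * b + \<phi> (a' / b') * b')
        = b * ((p - q) * \<phi> (a / b)) + b' * ((p - q) * \<phi> (a' / b'))"
      by (simp add: algebra_simps)
    also have "\<dots> \<le> b * ((a / b - q) * \<phi> p + (p - a / b) * \<phi> q)
        + b' * ((a' / b' - q) * \<phi> p + (p - a' / b') * \<phi> q)"
      using 1 2 b by (intro add_mono mult_left_mono) auto
    also have "\<dots> = (b * (a / b - q) + b' * (a' / b' - q)) * \<phi> p
        + (b * (p - a / b) + b' * (p - a' / b')) * \<phi> q"
      by (simp add: algebra_simps)
    also have "b * (a / b - q) + b' * (a' / b' - q) = (p - q) * b'"
      using b by (simp add: p_def q_def field_simps)
    also have "b * (p - a / b) + b' * (p - a' / b') = (p - q) * b"
      using b by (simp add: p_def q_def field_simps)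
    also have "(p - q) * b' * \<phi> p + (p - q) * b * \<phi> q = (p - q) * (\<phi> p * b' + \<phi> q * b)"
      by (simp add: algebra_simps)
    finally show ?thesis
      using pq by (simp add: p_def q_def)
  qed
qed

section \<open>Monotonicity and exchange for terms with possibly vanishing weights\<close>

lemma weighted_term_zero: "orlicz_function \<phi> \<Longrightarrow> weighted_term \<phi> 0 b = 0"
  by (simp add: weighted_term_def orlicz_zero)

lemma weighted_term_pos:
  assumes "orlicz_function \<phi>" "0 < c" "0 \<le> b"
  shows "0 < weighted_term \<phi> (ennreal c) b"
  using assms orlicz_less[of \<phi> 0 "c / b"]
  by (auto simp: weighted_term_def orlicz_zero intro!: mult_pos_pos)

lemma weighted_term_mono:
  assumes \<phi>: "orlicz_function \<phi>" and "a \<le> a'" "0 \<le> b'" "b' \<le> b"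
  shows "weighted_term \<phi> a b \<le> weighted_term \<phi> a' b'"
proof (cases "a' = \<infinity> \<or> b' = 0 \<and> a' \<noteq> 0")
  case True
  then show ?thesis by (auto simp: weighted_term_def)
next
  case False
  show ?thesis
  proof (cases "b' = 0")
    case True
    with False assms have "a = 0" by simp
    then show ?thesis by (simp add: weighted_term_zero[OF \<phi>])
  next
    case b': False
    have fin: "a < \<infinity>" "a' < \<infinity>"
      using False assms by (auto simp: less_top top_unique)
    have le: "enn2real a \<le> enn2real a'"
      using assms fin by (intro enn2real_mono) auto
    have "\<phi> (enn2real a / b) * b \<le> \<phi> (enn2real a' / b) * b"
      using assms b' le by (intro mult_right_mono orlicz_le[OF \<phi>] divide_right_mono) auto
    also have "\<dots> \<le> \<phi> (enn2real a' / b') * b'"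
      using assms b' by (intro perspective_antimono[OF \<phi>]) auto
    finally show ?thesis
      using assms b' fin by (auto simp: weighted_term_def intro: ennreal_leI)
  qed
qed

lemma weighted_term_exchange:
  assumes \<phi>: "orlicz_function \<phi>" and a: "0 \<le> a'" "a' \<le> a" and b: "0 \<le> b'" "b' \<le> b"
  shows "weighted_term \<phi> (ennreal a) b + weighted_term \<phi> (ennreal a') b'
    \<le> weighted_term \<phi> (ennreal a) b' + weighted_term \<phi> (ennreal a') b"
proof (cases "b' = 0")
  case True
  show ?thesis
  proof (cases "a = 0")
    case True
    with a show ?thesis by (simp add: weighted_term_zero[OF \<phi>])
  next
    case False
    with a have "weighted_term \<phi> (ennreal a) b' = \<infinity>"
      using \<open>b' = 0\<close> by (simp add: weighted_term_def)
    then show ?thesis by simp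
  qed
next
  case False
  have eq: "weighted_term \<phi> (ennreal c) d = ennreal (\<phi> (c / d) * d)"
    if "0 \<le> c" "0 < d" for c d
    using that by (simp add: weighted_term_def)
  have nn: "0 \<le> \<phi> (c / d) * d" if "0 \<le> c" "0 < d" for c d
    using that by (intro mult_nonneg_nonneg orlicz_nonneg[OF \<phi>]) auto
  have "\<phi> (a / b) * b + \<phi> (a' / b') * b' \<le> \<phi> (a / b') * b' + \<phi> (a' / b) * b"
    using \<phi> a b False by (intro perspective_exchange) (auto simp: orlicz_function_def)
  then show ?thesis
    using a b False by (simp add: eq nn ennreal_leI flip: ennreal_plus)
qed

text \<open>
  The hypothesis on \<open>u\<close> says that its decreasing rearrangement lies below \<open>w\<close>. Induction on
  \<open>N\<close>: move the smallest value of \<open>u\<close> to the last position by a transposition.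
\<close>

lemma sum_weighted_term_rearrangement:
  assumes \<phi>: "orlicz_function \<phi>" and "decseq a" and "\<And>n. 0 \<le> a n"
    and "\<And>i. i < N \<Longrightarrow> 0 \<le> u i"
    and "\<And>k. k < N \<Longrightarrow> card {i. i < N \<and> w k < u i} \<le> k"
  shows "(\<Sum>i<N. weighted_term \<phi> (ennreal (a i)) (w i))
    \<le> (\<Sum>i<N. weighted_term \<phi> (ennreal (a i)) (u i))"
  using assms(4,5)
proof (induction N arbitrary: u)
  case (Suc N)
  let ?G = "\<lambda>i b. weighted_term \<phi> (ennreal (a i)) b"
  obtain j where j: "j \<le> N" "\<And>i. i \<le> N \<Longrightarrow> u j \<le> u i"
    using ex_min_if_finite[of "u ` {..N}"] by (auto simp: not_less)
  \<comment> \<open>The minimum goes to the last place; for \<open>j = N\<close> nothing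
    changes.\<close>
  define u' where "u' = u(j := u N, N := u j)"
  have bij: "bij_betw (Transposition.transpose j N) {..N} {..N}"
    using j(1) by (intro permutes_imp_bij permutes_swap_id) auto
  have u': "u' = u \<circ> Transposition.transpose j N"
    by (auto simp: u'_def fun_eq_iff Transposition.transpose_def)
  have card_u': "card {i. i < Suc N \<and> w k < u' i} = card {i. i < Suc N \<and> w k < u i}" for k
  proof -
    have "{i. i < Suc N \<and> w k < u i} = Transposition.transpose j N ` {i. i < Suc N \<and> w k < u' i}"
      using bij j(1) by (force simp: u' image_iff Transposition.transpose_def split: if_splits)
    moreover have "inj_on (Transposition.transpose j N) {i. i < Suc N \<and> w k < u' i}"
      by (rule inj_on_subset[OF bij_is_inj[OF bij_transpose]]) simp
    ultimately show ?thesis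
      by (simp add: card_image)
  qed
  \<comment> \<open>Otherwise all \<open>N + 1\<close> values would exceed \<open>w N\<close>,
    against the counting hypothesis for \<open>k = N\<close>.\<close>
  have "u j \<le> w N"
  proof (rule ccontr)
    assume "\<not> u j \<le> w N"
    then have "{i. i < Suc N \<and> w N < u i} = {..N}"
      using j(2) by force
    with Suc.prems(2)[of N] show False by simp
  qed
  moreover have "(\<Sum>i<N. ?G i (w i)) \<le> (\<Sum>i<N. ?G i (u' i))"
  proof (rule Suc.IH)
    show "0 \<le> u' i" if "i < N" for i
      using that Suc.prems(1) j(1) by (auto simp: u'_def)
    show "card {i. i < N \<and> w k < u' i} \<le> k" if "k < N" for k
    proof -
      have "card {i. i < N \<and> w k < u' i} \<le> card {i. i < Suc N \<and> w k < u' i}"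
        by (intro card_mono) auto
      also have "\<dots> \<le> k"
        using Suc.prems(2)[of k] that by (simp only: card_u')
      finally show ?thesis .
    qed
  qed
  ultimately have "(\<Sum>i<Suc N. ?G i (w i)) \<le> (\<Sum>i<Suc N. ?G i (u' i))"
    using Suc.prems(1)[of j] j(1)
    by (auto simp: u'_def intro!: add_mono weighted_term_mono[OF \<phi>])
  \<comment> \<open>Undoing the transposition cannot decrease the sum: \<open>a N \<le> a j\<close>
    and \<open>u j \<le> u N\<close>, so the exchange inequality applies to the two moved
    terms.\<close>
  also have "\<dots> \<le> (\<Sum>i<Suc N. ?G i (u i))"
  proof (cases "j = N")
    case False
    with j(1) have jN: "j < N" by simp
    then have split: "(\<Sum>i<Suc N. f i) = (\<Sum>i\<in>{..<N} - {j}. f i) + (f j + f N)"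
      for f :: "nat \<Rightarrow> ennreal"
      by (simp add: sum.remove[of "{..<N}" j] ac_simps)
    have "?G j (u' j) + ?G N (u' N) \<le> ?G j (u j) + ?G N (u N)"
      using jN j(2)[of N] Suc.prems(1)[of j] assms(3)[of N] decseqD[OF assms(2), of j N]
      by (simp add: u'_def weighted_term_exchange[OF \<phi>])
    moreover have "(\<Sum>i\<in>{..<N} - {j}. ?G i (u' i)) = (\<Sum>i\<in>{..<N} - {j}. ?G i (u i))"
      by (intro sum.cong) (auto simp: u'_def)
    ultimately show ?thesis
      unfolding split by (simp add: add_mono)
  qed (simp add: u'_def)
  finally show ?case .
qed simp

section \<open>Series as integrals over counting measure\<close>

lemma suminf_infinite_lower_bound:
  fixes f :: "nat \<Rightarrow> ennreal"
  assumes "infinite S" "0 < e" "\<And>n. n \<in> S \<Longrightarrow> e \<le> f n"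
  shows "(\<Sum>n. f n) = \<infinity>"
proof -
  have "e * emeasure (count_space UNIV) S = (\<integral>\<^sup>+n. e * indicator S n \<partial>count_space UNIV)"
    by (simp add: nn_integral_cmult_indicator)
  also have "\<dots> \<le> (\<integral>\<^sup>+n. f n \<partial>count_space UNIV)"
    using assms by (intro nn_integral_mono) (auto simp: indicator_def)
  also have "\<dots> = (\<Sum>n. f n)"
    by (rule nn_integral_count_space_nat)
  finally show ?thesis
    using assms(1,2) by (auto simp: ennreal_mult_top top_unique split: if_splits)
qed

lemma suminf_reindex_supported:
  fixes f :: "nat \<Rightarrow> ennreal"
  assumes "inj \<tau>" "\<And>m. m \<notin> range \<tau> \<Longrightarrow> f m = 0"
  shows "(\<Sum>n. f (\<tau> n)) = (\<Sum>m. f m)"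
proof -
  have "(\<Sum>n. f (\<tau> n)) = (\<integral>\<^sup>+n. f (\<tau> n) \<partial>count_space UNIV)"
    by (simp add: nn_integral_count_space_nat)
  also have "\<dots> = (\<integral>\<^sup>+m. f m \<partial>count_space (range \<tau>))"
    using assms by (intro nn_integral_bij_count_space) (simp add: bij_betw_def)
  also have "\<dots> = (\<integral>\<^sup>+m. f m \<partial>count_space UNIV)"
    using assms(2) by (intro nn_integral_count_space_eq) auto
  finally show ?thesis
    by (simp add: nn_integral_count_space_nat)
qed

section \<open>Distribution functions and decreasing rearrangements\<close>

lemma decr_rearrangement_ge:
  assumes "\<And>s. 0 < s \<Longrightarrow> s < m \<Longrightarrow> of_nat n < distribution x s"
  shows "ennreal m \<le> decr_rearrangement x n"
  unfolding decr_rearrangement_def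
proof (rule Inf_greatest, clarify)
  fix s assume "0 < s" "distribution x s \<le> of_nat n"
  with assms[of s] have "m \<le> s" by (meson leD leI)
  then show "ennreal m \<le> ennreal s" by (rule ennreal_leI)
qed

lemma distribution_greater_card:
  assumes "finite S" "n < card S" "\<And>k. k \<in> S \<Longrightarrow> s < \<bar>x k\<bar>"
  shows "of_nat n < distribution x s"
proof -
  have "of_nat n < (of_nat (card S) :: ennreal)"
    using assms by simp
  also have "\<dots> = emeasure (count_space UNIV) S"
    using assms by (simp add: emeasure_count_space)
  also have "\<dots> \<le> distribution x s"
    unfolding distribution_def using assms by (intro emeasure_mono) auto
  finally show ?thesis .
qed

lemma decr_rearrangement_weight:
  assumes "weight_sequence w"
  shows "decr_rearrangement w n = ennreal (w n)"
proof (rule antisym)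
  have w: "0 \<le> w k" "decseq w" for k
    using assms by (auto simp: weight_sequence_def)
  show "ennreal (w n) \<le> decr_rearrangement w n"
  proof (rule decr_rearrangement_ge)
    fix s assume "s < w n"
    then show "of_nat n < distribution w s"
      using decseqD[OF w(2), of _ n]
      by (intro distribution_greater_card[of "{..n}"]) (force simp: w)+
  qed
  show "decr_rearrangement w n \<le> ennreal (w n)"
  \<comment> \<open>The slack \<open>e\<close> is needed because \<open>w n\<close> may be 0, while
    the infimum ranges over positive thresholds only.\<close>
  proof (rule ennreal_le_epsilon)
    fix e :: real assume e: "0 < e"
    have "distribution w (w n + e) \<le> emeasure (count_space UNIV) {..<n}"
      unfolding distribution_def
    proof (intro emeasure_mono subsetI)
      fix k assume "k \<in> {k. w n + e < \<bar>w k\<bar>}"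
      with e w decseqD[OF w(2), of n k] show "k \<in> {..<n}"
        by (force simp: not_less)
    qed simp
    then have "distribution w (w n + e) \<le> of_nat n"
      by (simp add: emeasure_count_space)
    moreover have "0 < w n + e" "ennreal (w n + e) = ennreal (w n) + ennreal e"
      using w(1)[of n] e by auto
    ultimately show "decr_rearrangement w n \<le> ennreal (w n) + ennreal e"
      unfolding decr_rearrangement_def by (intro Inf_lower) force
  qed
qed

text \<open>Only thresholds \<open>s > 0\<close> enter the rearrangement, so the zeros outside the
  range of \<tau> are invisible. This serves both to sort \<open>x\<close> and to build the
  minimizing \<open>v\<close>.\<close>

lemma decr_rearrangement_reindex:
  assumes "inj \<tau>" "\<And>n. \<bar>z (\<tau> n)\<bar> = \<bar>y n\<bar>" "\<And>m. m \<notin> range \<tau> \<Longrightarrow> z m = 0"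
  shows "decr_rearrangement z = decr_rearrangement y"
proof -
  have "distribution z s = distribution y s" if "0 < s" for s
  proof -
    have "{k. s < \<bar>z k\<bar>} = \<tau> ` {k. s < \<bar>y k\<bar>}"
    proof (intro set_eqI iffI)
      fix m assume m: "m \<in> {k. s < \<bar>z k\<bar>}"
      with that assms(3)[of m] have "m \<in> range \<tau>" by force
      with m assms(2) show "m \<in> \<tau> ` {k. s < \<bar>y k\<bar>}" by auto
    qed (use assms(2) in auto)
    moreover have "inj_on \<tau> {k. s < \<bar>y k\<bar>}"
      using assms(1) by (rule inj_on_subset) simp
    ultimately show ?thesis
      unfolding distribution_def
      by (simp add: emeasure_count_space card_image finite_image_iff)
  qed
  then show ?thesis
    unfolding decr_rearrangement_def by (intro ext arg_cong[where f = Inf]) auto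
qed

text \<open>Turns equimeasurability into the counting hypothesis of
  \<open>sum_weighted_term_rearrangement\<close>. If \<open>S\<close> had more than \<open>k\<close>
  elements, the minimum \<open>m\<close> of \<open>v\<close> on \<open>S\<close> would bound entry
  \<open>k\<close> of the rearrangement from below; as \<open>S\<close> is finite, \<open>m\<close>
  still exceeds \<open>w k\<close> strictly.\<close>

lemma equimeasurable_weight_card_le:
  assumes w: "weight_sequence w" and v: "equimeasurable v w" "\<And>n. 0 \<le> v n"
    and S: "finite S" "\<And>n. n \<in> S \<Longrightarrow> w k < v n"
  shows "card S \<le> k"
proof (rule ccontr)
  assume k: "\<not> card S \<le> k"
  then have ne: "S \<noteq> {}" by auto
  define m where "m = Min (v ` S)"
  have m: "m \<le> v n" if "n \<in> S" for n
    using that S(1) by (simp add: m_def)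
  have "ennreal m \<le> decr_rearrangement v k"
    using k S(1) m v(2) by (intro decr_rearrangement_ge distribution_greater_card[of S]) force+
  also have "\<dots> = ennreal (w k)"
    using v(1) decr_rearrangement_weight[OF w] by (simp add: equimeasurable_def)
  finally have "m \<le> w k"
    using w by (simp add: weight_sequence_def)
  moreover have "w k < m"
    using S ne by (simp add: m_def)
  ultimately show False by simp
qed

lemma decreasing_enumeration:
  fixes x :: "nat \<Rightarrow> real"
  assumes fin: "\<And>c. 0 < c \<Longrightarrow> finite {k. c < \<bar>x k\<bar>}"
  obtains \<tau> :: "nat \<Rightarrow> nat"
  where "inj \<tau>" "decseq (\<lambda>n. \<bar>x (\<tau> n)\<bar>)" "\<And>m. m \<notin> range \<tau> \<Longrightarrow> x m = 0"
proof -
  define P where "P f n r \<longleftrightarrow>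
    r \<notin> f ` {..<n} \<and> (\<forall>m. m \<notin> f ` {..<n} \<longrightarrow> \<bar>x m\<bar> \<le> \<bar>x r\<bar>)" for f :: "nat \<Rightarrow> nat" and n r
  have "\<exists>\<tau>. \<forall>n. P \<tau> n (\<tau> n)"
  proof (rule dependent_wellorder_choice)
    fix r n and f g :: "nat \<Rightarrow> nat"
    assume "\<And>m. m < n \<Longrightarrow> f m = g m"
    then have "f ` {..<n} = g ` {..<n}" by (intro image_cong) auto
    then show "P f n r = P g n r" by (simp add: P_def)
  next
    fix n and f :: "nat \<Rightarrow> nat"
    define A where "A = - f ` {..<n}"
    have "infinite A"
      by (simp add: A_def Compl_eq_Diff_UNIV)
    then obtain k where k: "k \<in> A"
      using infinite_imp_nonempty by blast
    have "\<exists>r\<in>A. \<forall>m\<in>A. \<bar>x m\<bar> \<le> \<bar>x r\<bar>"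
    proof (cases "\<exists>k\<in>A. x k \<noteq> 0")
      case False
      with k show ?thesis by auto
    next
      case True
      then obtain k where k: "k \<in> A" "x k \<noteq> 0" by blast
      \<comment> \<open>Half of \<open>\<bar>x k\<bar>\<close> is a positive threshold strictly
        below \<open>\<bar>x k\<bar>\<close>: \<open>B\<close> is finite and contains
        \<open>k\<close>, and indices of \<open>A\<close> outside \<open>B\<close> cannot beat
        \<open>k\<close>.\<close>
      define B where "B = A \<inter> {m. \<bar>x k\<bar> / 2 < \<bar>x m\<bar>}"
      have B: "finite B" "k \<in> B"
        using fin[of "\<bar>x k\<bar> / 2"] k by (auto simp: B_def)
      obtain r where r: "r \<in> B" "\<bar>x r\<bar> = Max ((\<lambda>m. \<bar>x m\<bar>) ` B)"
        using Max_in[of "(\<lambda>m. \<bar>x m\<bar>) ` B"] B by fastforce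
      have rB: "\<bar>x m\<bar> \<le> \<bar>x r\<bar>" if "m \<in> B" for m
        using that B(1) by (simp add: r(2))
      have "\<bar>x m\<bar> \<le> \<bar>x r\<bar>" if "m \<in> A" for m
        using that rB[of m] rB[OF B(2)] by (cases "m \<in> B") (auto simp: B_def)
      with r(1) show ?thesis by (auto simp: B_def)
    qed
    then show "\<exists>r. P f n r"
      by (auto simp: P_def A_def)
  qed
  then obtain \<tau> where \<tau>: "\<And>n. P \<tau> n (\<tau> n)" by blast
  have new: "\<tau> n \<notin> \<tau> ` {..<n}" for n
    using \<tau>[of n] by (simp add: P_def)
  have max: "\<bar>x m\<bar> \<le> \<bar>x (\<tau> n)\<bar>" if "m \<notin> \<tau> ` {..<n}" for m n
    using \<tau>[of n] that by (simp add: P_def)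
  have inj: "inj \<tau>"
  proof (rule linorder_injI)
    show "\<tau> m \<noteq> \<tau> n" if "m < n" for m n
      using new[of n] that by (metis imageI lessThan_iff)
  qed
  show ?thesis
  proof
    show "inj \<tau>" by fact
    show "decseq (\<lambda>n. \<bar>x (\<tau> n)\<bar>)"
      using inj by (auto simp: decseq_def inj_eq intro!: max)
    show "x m = 0" if "m \<notin> range \<tau>" for m
    proof (rule ccontr)
      assume "x m \<noteq> 0"
      moreover from this have "\<bar>x m\<bar> / 2 < \<bar>x (\<tau> n)\<bar>" for n
        using max[of m n] that by force
      then have "range \<tau> \<subseteq> {k. \<bar>x m\<bar> / 2 < \<bar>x k\<bar>}" by auto
      ultimately have "finite (range \<tau>)"
        using fin[of "\<bar>x m\<bar> / 2"] by (auto intro: finite_subset)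
      then show False
        using inj finite_imageD by blast
    qed
  qed
qed

section \<open>The infimum formula\<close>

theorem theorem2p4:
  fixes \<phi> :: "real \<Rightarrow> real" and w x :: "nat \<Rightarrow> real"
  assumes "orlicz_function \<phi>"
    and "weight_sequence w"
  shows "(\<Sum>n. weighted_term \<phi> (decr_rearrangement x n) (w n)) =
    (INF v\<in>{v. equimeasurable v w \<and> (\<forall>n. 0 \<le> v n)}.
       \<Sum>n. weighted_term \<phi> (ennreal \<bar>x n\<bar>) (v n))"
proof (cases "\<exists>c>0. infinite {k. c < \<bar>x k\<bar>}")
  case True
  then obtain c where c: "0 < c" "infinite {k. c < \<bar>x k\<bar>}" by blast
  have w: "0 \<le> w n" "w n \<le> w 0" for n
    using assms(2) by (auto simp: weight_sequence_def decseq_def)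
  \<comment> \<open>As \<open>w 0\<close> bounds all \<open>w n\<close> and all \<open>v n\<close>,
    this one constant lies below infinitely many terms of either series.\<close>
  let ?e = "weighted_term \<phi> (ennreal c) (w 0)"
  have e: "0 < ?e"
    using weighted_term_pos[OF assms(1) c(1) w(1)] .
  have "ennreal c \<le> decr_rearrangement x n" for n
  proof (rule decr_rearrangement_ge)
    fix s assume "s < c"
    obtain S where "S \<subseteq> {k. c < \<bar>x k\<bar>}" "finite S" "card S = Suc n"
      using infinite_arbitrarily_large[OF c(2)] by blast
    with \<open>s < c\<close> show "of_nat n < distribution x s"
      by (intro distribution_greater_card[of S]) force+
  qed
  then have "(\<Sum>n. weighted_term \<phi> (decr_rearrangement x n) (w n)) = \<infinity>"
    using w by (intro suminf_infinite_lower_bound[OF _ e, of UNIV] weighted_term_mono[OF assms(1)]) auto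
  moreover have "(\<Sum>n. weighted_term \<phi> (ennreal \<bar>x n\<bar>) (v n)) = \<infinity>"
    if v: "equimeasurable v w" "\<And>n. 0 \<le> v n" for v
  proof (rule suminf_infinite_lower_bound[OF c(2) e])
    fix n assume n: "n \<in> {k. c < \<bar>x k\<bar>}"
    have "v n \<le> w 0"
      using equimeasurable_weight_card_le[OF assms(2) v, of "{n}" 0] by force
    with n v show "?e \<le> weighted_term \<phi> (ennreal \<bar>x n\<bar>) (v n)"
      by (intro weighted_term_mono[OF assms(1)] ennreal_leI) auto
  qed
  ultimately show ?thesis
    by (auto simp: INF_top_conv intro!: antisym INF_greatest)
next
  case False
  then have fin: "finite {k. c < \<bar>x k\<bar>}" if "0 < c" for c
    using that by blast
  obtain \<tau> where \<tau>: "inj \<tau>" "decseq (\<lambda>n. \<bar>x (\<tau> n)\<bar>)" "\<And>m. m \<notin> range \<tau> \<Longrightarrow> x m = 0"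
    using decreasing_enumeration[OF fin] by blast
  \<comment> \<open>The sorted moduli form a weight sequence, hence are their own
    rearrangement.\<close>
  have "decr_rearrangement x = decr_rearrangement (\<lambda>n. \<bar>x (\<tau> n)\<bar>)"
    using \<tau> by (intro decr_rearrangement_reindex[of \<tau>]) auto
  then have xstar: "decr_rearrangement x n = ennreal \<bar>x (\<tau> n)\<bar>" for n
    using \<tau>(2) by (simp add: decr_rearrangement_weight weight_sequence_def)
  show ?thesis
  proof (rule antisym)
    show "(\<Sum>n. weighted_term \<phi> (decr_rearrangement x n) (w n)) \<le>
      (INF v\<in>{v. equimeasurable v w \<and> (\<forall>n. 0 \<le> v n)}.
         \<Sum>n. weighted_term \<phi> (ennreal \<bar>x n\<bar>) (v n))"
    proof (rule INF_greatest)
      fix v assume "v \<in> {v. equimeasurable v w \<and> (\<forall>n. 0 \<le> v n)}"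
      then have v: "equimeasurable v w" "\<forall>n. 0 \<le> v n" by auto
      show "(\<Sum>n. weighted_term \<phi> (decr_rearrangement x n) (w n))
        \<le> (\<Sum>n. weighted_term \<phi> (ennreal \<bar>x n\<bar>) (v n))"
        unfolding xstar
      proof (rule suminf_le_const)
        fix N
        \<comment> \<open>The sequence \<open>v (\<tau> i)\<close> may omit entries of
          \<open>v\<close>, but by injectivity of \<tau> the upper bound on the counts
          survives.\<close>
        have "card {i. i < N \<and> w k < v (\<tau> i)} \<le> k" for k
        proof -
          have "card {i. i < N \<and> w k < v (\<tau> i)} = card (\<tau> ` {i. i < N \<and> w k < v (\<tau> i)})"
            by (rule card_image[symmetric], rule inj_on_subset[OF \<tau>(1)]) simp
          also have "\<dots> \<le> k"
            using v by (intro equimeasurable_weight_card_le[OF assms(2) v(1)]) auto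
          finally show ?thesis .
        qed
        then have "(\<Sum>n<N. weighted_term \<phi> (ennreal \<bar>x (\<tau> n)\<bar>) (w n))
          \<le> (\<Sum>n<N. weighted_term \<phi> (ennreal \<bar>x (\<tau> n)\<bar>) (v (\<tau> n)))"
          using v(2) \<tau>(2) by (intro sum_weighted_term_rearrangement[OF assms(1)]) auto
        also have "\<dots> = (\<Sum>m\<in>\<tau> ` {..<N}. weighted_term \<phi> (ennreal \<bar>x m\<bar>) (v m))"
          using \<tau>(1) by (subst sum.reindex[OF inj_on_subset[OF \<tau>(1)]]) auto
        also have "\<dots> \<le> (\<Sum>m. weighted_term \<phi> (ennreal \<bar>x m\<bar>) (v m))"
          by (intro sum_le_suminf) auto
        finally show "(\<Sum>n<N. weighted_term \<phi> (ennreal \<bar>x (\<tau> n)\<bar>) (w n))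
          \<le> (\<Sum>m. weighted_term \<phi> (ennreal \<bar>x m\<bar>) (v m))" .
      qed simp
    qed
    \<comment> \<open>The minimizer pairs \<open>w n\<close> with the \<open>n\<close>-th largest
      modulus. Off the range of \<tau> both \<open>x\<close> and \<open>v\<close> vanish, and the
      convention for zero weight makes these terms 0.\<close>
    define v where "v m = (if m \<in> range \<tau> then w (inv \<tau> m) else 0)" for m
    have v\<tau>: "v (\<tau> n) = w n" for n
      using \<tau>(1) by (simp add: v_def)
    have "equimeasurable v w"
      unfolding equimeasurable_def using \<tau>(1) v\<tau>
      by (intro decr_rearrangement_reindex[of \<tau>]) (auto simp: v_def)
    moreover have "\<forall>n. 0 \<le> v n"
      using assms(2) by (simp add: v_def weight_sequence_def)
    ultimately have "(INF v\<in>{v. equimeasurable v w \<and> (\<forall>n. 0 \<le> v n)}.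
        \<Sum>n. weighted_term \<phi> (ennreal \<bar>x n\<bar>) (v n))
      \<le> (\<Sum>m. weighted_term \<phi> (ennreal \<bar>x m\<bar>) (v m))"
      by (intro INF_lower) auto
    also have "\<dots> = (\<Sum>n. weighted_term \<phi> (ennreal \<bar>x (\<tau> n)\<bar>) (v (\<tau> n)))"
      using \<tau> by (intro suminf_reindex_supported[symmetric]) (auto simp: weighted_term_zero[OF assms(1)])
    also have "\<dots> = (\<Sum>n. weighted_term \<phi> (decr_rearrangement x n) (w n))"
      by (simp add: xstar v\<tau>)
    finally show "(INF v\<in>{v. equimeasurable v w \<and> (\<forall>n. 0 \<le> v n)}.
        \<Sum>n. weighted_term \<phi> (ennreal \<bar>x n\<bar>) (v n))
      \<le> (\<Sum>n. weighted_term \<phi> (decr_rearrangement x n) (w n))" .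
  qed
qed

end
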